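(* For each prime $p$ there is a nilpotent $p$-group which is a BCN-group and which is neither abelian-by-finite nor finite-by-abelian.
   Context: For a subgroup $H$ of a group $G$, let $\delta_G(H)$ be the minimum of the indices $|HN:(H\cap N)|$ as $N$ ranges over the normal subgroups of $G$. $G$ is a BCN-group if there is $n\in\mathbb{N}$ such that $\delta_G(H)\le n$ for all $H\le G$. A $p$-group is a (possibly infinite) group in which every element has order a power of $p$. A group is abelian-by-finite if it has an abelian subgroup of finite index, and finite-by-abelian if its derived subgroup is finite. *)

theory Defs
  imports
    "HOL-Algebra.Algebra"
    "HOL-Computational_Algebra.Primes"
    "HOL-Library.Extended_Nat"
begin

text \<open>
  The index \<open>|K : H|\<close> of a subgroup \<open>H\<close> of \<open>K\<close>, where \<open>K\<close> is itself a subgroup of \<open>G\<close>.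
  All infinite indices are identified with \<open>\<infinity>\<close>.
\<close>

definition subgroup_index :: "('a, 'b) monoid_scheme \<Rightarrow> 'a set \<Rightarrow> 'a set \<Rightarrow> enat" where
  "subgroup_index G K H =
     (let C = rcosets\<^bsub>G\<lparr>carrier := K\<rparr>\<^esub> H in if finite C then enat (card C) else \<infinity>)"

text \<open>
  Since \<open>enat\<close> is well-ordered and there is at least one normal subgroup, the infimum
  below is a minimum; see \<open>delta_attained\<close>.
\<close>

definition delta :: "('a, 'b) monoid_scheme \<Rightarrow> 'a set \<Rightarrow> enat" where
  "delta G H = (INF N\<in>{N. N \<lhd> G}. subgroup_index G (H <#>\<^bsub>G\<^esub> N) (H \<inter> N))"

lemma delta_attained:
  assumes "group G"
  shows "\<exists>N. N \<lhd> G \<and> delta G H = subgroup_index G (H <#>\<^bsub>G\<^esub> N) (H \<inter> N)"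
proof -
  have "carrier G \<lhd> G"
    using group.normal_inv_iff[OF assms] group.subgroup_self[OF assms]
      group.is_monoid[OF assms] by (auto intro: monoid.m_closed group.inv_closed[OF assms])
  then have "(\<lambda>N. subgroup_index G (H <#>\<^bsub>G\<^esub> N) (H \<inter> N)) ` {N. N \<lhd> G} \<noteq> {}"
    by blast
  then have "delta G H \<in> (\<lambda>N. subgroup_index G (H <#>\<^bsub>G\<^esub> N) (H \<inter> N)) ` {N. N \<lhd> G}"
    unfolding delta_def Inf_enat_def by (auto intro: LeastI)
  then show ?thesis by blast
qed

definition BCN_group :: "('a, 'b) monoid_scheme \<Rightarrow> bool" where
  "BCN_group G \<longleftrightarrow>
     group G \<and> (\<exists>n::nat. \<forall>H. subgroup H G \<longrightarrow> delta G H \<le> enat n)"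

text \<open>
  \<open>group.ord G x\<close> is \<open>0\<close> for an element of infinite order, so elements of infinite
  order are excluded.
\<close>

definition p_group :: "nat \<Rightarrow> ('a, 'b) monoid_scheme \<Rightarrow> bool" where
  "p_group p G \<longleftrightarrow> group G \<and> (\<forall>x\<in>carrier G. \<exists>k::nat. group.ord G x = p ^ k)"

text \<open>The lower central series, starting at index \<open>0\<close> with the whole group.\<close>

primrec lower_central :: "('a, 'b) monoid_scheme \<Rightarrow> nat \<Rightarrow> 'a set" where
  "lower_central G 0 = carrier G"
| "lower_central G (Suc n) =
     generate G (\<Union>x\<in>lower_central G n. \<Union>y\<in>carrier G.
       {x \<otimes>\<^bsub>G\<^esub> y \<otimes>\<^bsub>G\<^esub> inv\<^bsub>G\<^esub> x \<otimes>\<^bsub>G\<^esub> inv\<^bsub>G\<^esub> y})"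

definition nilpotent_group :: "('a, 'b) monoid_scheme \<Rightarrow> bool" where
  "nilpotent_group G \<longleftrightarrow> group G \<and> (\<exists>n. lower_central G n = {\<one>\<^bsub>G\<^esub>})"

definition abelian_by_finite :: "('a, 'b) monoid_scheme \<Rightarrow> bool" where
  "abelian_by_finite G \<longleftrightarrow>
     group G \<and>
     (\<exists>A. subgroup A G \<and> comm_group (G\<lparr>carrier := A\<rparr>) \<and> subgroup_index G (carrier G) A < \<infinity>)"

definition finite_by_abelian :: "('a, 'b) monoid_scheme \<Rightarrow> bool" where
  "finite_by_abelian G \<longleftrightarrow> group G \<and> finite (derived G (carrier G))"

end

theory Submission
  imports Defs "HOL-Number_Theory.Cong"
begin

text \<open>
  Two constructions are fused. An infinite extraspecial-like \<open>p\<close>-group is far from abelian-by-finite,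
  yet each of its subgroups becomes normal after multiplication by the derived group, which has order
  \<open>p\<close>. Dually, let an element of order \<open>p\<close> act on a direct sum of infinitely many copies of
  \<open>\<int>/p\<^sup>2\<close> as the power automorphism \<open>a \<mapsto> (1 + p) a\<close>: the derived group \<open>pA\<close> is infinite, yet
  every subgroup of \<open>A\<close> stays normal, because a power automorphism preserves every subgroup.

  Both live in one group \<open>G\<close> of triples \<open>(k, z, a)\<close> with \<open>k, z \<in> \<int>/p\<close> and \<open>a\<close> a finitely supported
  sequence over \<open>\<int>/p\<^sup>2\<close>, multiplied by
    \<open>(k, z, a) (l, w, b) = (k + l, z + w + \<beta>(a, b), (1 + p l) a + b)\<close>,
  where \<open>\<beta>(a, b)\<close> is the sum of all \<open>a\<^sub>2\<^sub>i b\<^sub>2\<^sub>i\<^sub>+\<^sub>1\<close> modulo \<open>p\<close>.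
  The two features do not disturb each other: \<open>1 + pl\<close> is \<open>1\<close> modulo \<open>p\<close>, so the twist does not change
  \<open>\<beta>\<close>, and \<open>\<beta>\<close> takes values in the central subgroup \<open>Z = {(0, z, 0)}\<close> of order \<open>p\<close>.

  All commutators lie in \<open>C = {(0, z, pa)}\<close> (\<open>commutator_in_C\<close>), on which both \<open>\<beta>\<close> and the twist are
  trivial; so \<open>C\<close> is central (\<open>C_central\<close>) and the class is \<open>2\<close>. Modulo \<open>Z\<close> the subgroup
  \<open>base = {k = 0}\<close> of index \<open>p\<close> is abelian and \<open>G\<close> acts on it by powers (\<open>conj_eq_power\<close>). Hence
  \<open>N = (H \<inter> base) Z\<close> is normal for every subgroup \<open>H\<close>, and \<open>HN = HZ\<close> exceeds \<open>H \<inter> N = H \<inter> base\<close> by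
  a factor of at most \<open>p\<close> for \<open>Z\<close> and at most \<open>p\<close> for \<open>base\<close> (\<open>delta_le\<close>).

  The commutators of \<open>(1, 0, 0)\<close> with the unit vectors \<open>(0, 0, e\<^sub>i)\<close> have last component \<open>p e\<^sub>i\<close>, so the
  derived group is infinite. A subgroup of finite index contains, by the pigeonhole principle,
  quotients of unit vectors on which \<open>\<beta>\<close> is not symmetric, so it is not abelian.
\<close>

section \<open>Indices and generated subgroups\<close>

lemma subgroup_index_le_card_transversal:
  fixes G (structure)
  assumes "group G" and "subgroup L G" and "K \<subseteq> carrier G"
    and "finite T" and "T \<subseteq> carrier G" and cover: "\<And>x. x \<in> K \<Longrightarrow> \<exists>t\<in>T. x \<in> L #> t"
  shows "subgroup_index G K L \<le> enat (card T)"
proof -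
  interpret group G by fact
  have "rcosets\<^bsub>G\<lparr>carrier := K\<rparr>\<^esub> L \<subseteq> (\<lambda>t. L #> t) ` T"
  proof
    fix C assume "C \<in> rcosets\<^bsub>G\<lparr>carrier := K\<rparr>\<^esub> L"
    then obtain x where x: "x \<in> K" "C = L #> x"
      by (auto simp: RCOSETS_def r_coset_def)
    obtain t where t: "t \<in> T" "x \<in> L #> t"
      using cover[OF x(1)] by blast
    have "L #> t = L #> x"
      using t x assms by (intro repr_independence) auto
    then show "C \<in> (\<lambda>t. L #> t) ` T"
      using t x by blast
  qed
  moreover have "finite ((\<lambda>t. L #> t) ` T)" "card ((\<lambda>t. L #> t) ` T) \<le> card T"
    using \<open>finite T\<close> by (auto intro: card_image_le)
  ultimately have "finite (rcosets\<^bsub>G\<lparr>carrier := K\<rparr>\<^esub> L)" "card (rcosets\<^bsub>G\<lparr>carrier := K\<rparr>\<^esub> L) \<le> card T"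
    by (auto intro: finite_subset dest: card_mono)
  then show ?thesis
    by (simp add: subgroup_index_def Let_def)
qed

lemma (in group) generate_commutes:
  assumes "x \<in> generate G S" and "S \<subseteq> carrier G" and "g \<in> carrier G"
    and comm: "\<And>s. s \<in> S \<Longrightarrow> s \<otimes> g = g \<otimes> s"
  shows "x \<otimes> g = g \<otimes> x"
  using assms(1)
proof (induction rule: generate.induct)
  case (inv s)
  then have "s \<in> carrier G"
    using \<open>S \<subseteq> carrier G\<close> by blast
  then have "g \<otimes> inv s = inv s \<otimes> (s \<otimes> g) \<otimes> inv s"
    using \<open>g \<in> carrier G\<close> by (simp add: m_assoc[symmetric])
  also have "\<dots> = inv s \<otimes> g"
    using \<open>s \<in> carrier G\<close> \<open>g \<in> carrier G\<close> by (simp add: comm[OF inv] m_assoc)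
  finally show ?case by simp
next
  case (eng x y)
  have "x \<in> carrier G" "y \<in> carrier G"
    using eng generate_in_carrier[OF \<open>S \<subseteq> carrier G\<close>] by auto
  then show ?case
    using eng.IH \<open>g \<in> carrier G\<close> by (metis m_assoc)
qed (use \<open>g \<in> carrier G\<close> comm in auto)

section \<open>The twisted Heisenberg group\<close>

locale twisted_heisenberg =
  fixes p :: nat
  assumes prime_p: "Factorial_Ring.prime p"
begin

text \<open>
  A triple \<open>(k, z, a)\<close> is encoded as one function \<open>f\<close> with \<open>f 0 = k\<close>, \<open>f 1 = z\<close> and
  \<open>f (n + 2) = a\<^sub>n\<close>, each entry being the least non-negative residue modulo \<open>modulus n\<close>.
\<close>

definition modulus :: "nat \<Rightarrow> int" where
  "modulus n = (if n < 2 then int p else (int p)\<^sup>2)"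

text \<open>
  The form \<open>\<beta>\<close>. Summing over the support of the left argument makes it additive in the right
  argument without any condition; additivity on the left requires finite supports.
\<close>

definition pairing :: "(nat \<Rightarrow> int) \<Rightarrow> (nat \<Rightarrow> int) \<Rightarrow> int" where
  "pairing f g = (\<Sum>i | f (2*i+2) \<noteq> 0. f (2*i+2) * g (2*i+3))"

definition raw_mult :: "(nat \<Rightarrow> int) \<Rightarrow> (nat \<Rightarrow> int) \<Rightarrow> nat \<Rightarrow> int" where
  "raw_mult f g n =
     (if n = 0 then f 0 + g 0
      else if n = 1 then f 1 + g 1 + pairing f g
      else f n * (1 + int p * g 0) + g n)"

definition reduce :: "(nat \<Rightarrow> int) \<Rightarrow> nat \<Rightarrow> int" where
  "reduce f n = f n mod modulus n"

definition G :: "(nat \<Rightarrow> int) monoid" where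
  "G = \<lparr>carrier = {f. finite {n. f n \<noteq> 0} \<and> reduce f = f},
        monoid.mult = (\<lambda>f g. reduce (raw_mult f g)), one = (\<lambda>_. 0)\<rparr>"

lemma p_gt_1: "int p > 1"
  using prime_gt_1_nat[OF prime_p] by simp

lemma modulus_pos: "modulus n > 0"
  using p_gt_1 by (simp add: modulus_def)

lemma modulus_simps [simp]: "modulus 0 = int p" "modulus (Suc 0) = int p"
  "n \<ge> 2 \<Longrightarrow> modulus n = (int p)\<^sup>2"
  by (auto simp: modulus_def)

lemma reduce_reduce [simp]: "reduce (reduce f) = reduce f"
  by (rule ext) (simp add: reduce_def)

lemma reduce_in_carrier:
  assumes "finite {n. f n \<noteq> 0}"
  shows "reduce f \<in> carrier G"
proof -
  have "finite {n. reduce f n \<noteq> 0}"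
    using assms by (rule finite_subset[rotated]) (auto simp: reduce_def)
  then show ?thesis by (simp add: G_def)
qed

lemma carrier_finite_support: "f \<in> carrier G \<Longrightarrow> finite {n. f n \<noteq> 0}"
  by (simp add: G_def)

lemma carrier_mod: "f \<in> carrier G \<Longrightarrow> f n mod modulus n = f n"
  unfolding G_def reduce_def by (auto dest: fun_cong)

lemma carrier_range: "f \<in> carrier G \<Longrightarrow> 0 \<le> f n \<and> f n < modulus n"
  using carrier_mod[of f n] modulus_pos[of n] by (metis pos_mod_bound pos_mod_sign)

text \<open>
  Equality in \<open>G\<close> is componentwise congruence, so that all computations below can be done with
  unreduced integers.
\<close>

lemma carrier_eqI:
  assumes "f \<in> carrier G" "g \<in> carrier G"
    and "[f 0 = g 0] (mod int p)" and "[f 1 = g 1] (mod int p)"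
    and "\<And>n. n \<ge> 2 \<Longrightarrow> [f n = g n] (mod (int p)\<^sup>2)"
  shows "f = g"
proof
  fix n
  have "[f n = g n] (mod modulus n)"
  proof (cases "n \<ge> 2")
    case False
    then have "n = 0 \<or> n = 1" by linarith
    then show ?thesis using assms by auto
  qed (use assms in auto)
  then show "f n = g n"
    using carrier_mod[OF assms(1), of n] carrier_mod[OF assms(2), of n] by (simp add: cong_def)
qed

lemma one_G [simp]: "\<one>\<^bsub>G\<^esub> n = 0"
  by (simp add: G_def)

lemma mult_G: "f \<otimes>\<^bsub>G\<^esub> g = reduce (raw_mult f g)"
  by (simp add: G_def)

lemma mult_0: "[(f \<otimes>\<^bsub>G\<^esub> g) 0 = f 0 + g 0] (mod int p)"
  by (simp add: mult_G reduce_def raw_mult_def cong_def)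

lemma mult_1: "[(f \<otimes>\<^bsub>G\<^esub> g) 1 = f 1 + g 1 + pairing f g] (mod int p)"
  by (simp add: mult_G reduce_def raw_mult_def cong_def)

lemma mult_2: "n \<ge> 2 \<Longrightarrow> [(f \<otimes>\<^bsub>G\<^esub> g) n = f n * (1 + int p * g 0) + g n] (mod (int p)\<^sup>2)"
  by (simp add: mult_G reduce_def raw_mult_def cong_def)

text \<open>
  Modulo \<open>p\<close> the twist disappears. This is why the form sees a plain sum and stays biadditive on \<open>G\<close>,
  although the last component is multiplied in a twisted way.
\<close>

lemma mult_2_mod_p:
  assumes "n \<ge> 2"
  shows "[(f \<otimes>\<^bsub>G\<^esub> g) n = f n + g n] (mod int p)"
proof -
  have "[(f \<otimes>\<^bsub>G\<^esub> g) n = f n * (1 + int p * g 0) + g n] (mod int p)"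
    using mult_2[OF assms] by (rule cong_dvd_modulus) (simp add: power2_eq_square)
  also have "[f n * (1 + int p * g 0) + g n = f n + g n] (mod int p)"
    by (simp add: cong_iff_dvd_diff algebra_simps)
  finally show ?thesis .
qed

lemma pairing_add_right: "pairing f (\<lambda>n. g n + h n) = pairing f g + pairing f h"
  by (simp add: pairing_def sum.distrib distrib_left)

lemma pairing_superset:
  assumes "finite S" "\<And>i. i \<notin> S \<Longrightarrow> f (2*i+2) = 0"
  shows "pairing f g = (\<Sum>i\<in>S. f (2*i+2) * g (2*i+3))"
  unfolding pairing_def using assms by (intro sum.mono_neutral_left) auto

lemma finite_pairing_support:
  assumes "finite {n::nat. f n \<noteq> (0::int)}"
  shows "finite {i. f (2*i+2) \<noteq> 0}"
proof -
  have "inj (\<lambda>i::nat. 2*i+2)"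
    by (auto simp: inj_def)
  from finite_vimageI[OF assms this] show ?thesis
    by (simp add: vimage_def)
qed

lemma pairing_cong:
  assumes "finite {n. f n \<noteq> 0}" "finite {n. f' n \<noteq> 0}"
    and "\<And>n. n \<ge> 2 \<Longrightarrow> [f n = f' n] (mod int p)" "\<And>n. n \<ge> 2 \<Longrightarrow> [g n = g' n] (mod int p)"
  shows "[pairing f g = pairing f' g'] (mod int p)"
proof -
  define S where "S = {i. f (2*i+2) \<noteq> 0} \<union> {i. f' (2*i+2) \<noteq> 0}"
  have fin: "finite S"
    unfolding S_def using assms finite_pairing_support by blast
  have "pairing f g = (\<Sum>i\<in>S. f (2*i+2) * g (2*i+3))"
    "pairing f' g' = (\<Sum>i\<in>S. f' (2*i+2) * g' (2*i+3))"
    by (rule pairing_superset[OF fin]; simp add: S_def)+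
  then show ?thesis
    using assms by (auto intro!: cong_sum cong_mult)
qed

lemma pairing_add_left:
  assumes "finite {n. f n \<noteq> 0}" "finite {n. g n \<noteq> 0}"
  shows "pairing (\<lambda>n. f n + g n) h = pairing f h + pairing g h"
proof -
  define S where "S = {i. f (2*i+2) \<noteq> 0} \<union> {i. g (2*i+2) \<noteq> 0}"
  have fin: "finite S"
    unfolding S_def using assms finite_pairing_support by blast
  have "pairing (\<lambda>n. f n + g n) h = (\<Sum>i\<in>S. (f (2*i+2) + g (2*i+2)) * h (2*i+3))"
    "pairing f h = (\<Sum>i\<in>S. f (2*i+2) * h (2*i+3))"
    "pairing g h = (\<Sum>i\<in>S. g (2*i+2) * h (2*i+3))"
    by (rule pairing_superset[OF fin]; simp add: S_def)+
  then show ?thesis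
    by (simp add: sum.distrib distrib_right)
qed

lemma pairing_zero_left: "(\<And>n. n \<ge> 2 \<Longrightarrow> f n = 0) \<Longrightarrow> pairing f g = 0"
  by (simp add: pairing_def)

lemma pairing_zero_right: "(\<And>n. n \<ge> 2 \<Longrightarrow> g n = 0) \<Longrightarrow> pairing f g = 0"
  by (simp add: pairing_def)

lemma mult_closed:
  assumes "f \<in> carrier G" "g \<in> carrier G"
  shows "f \<otimes>\<^bsub>G\<^esub> g \<in> carrier G"
proof -
  have "{n. raw_mult f g n \<noteq> 0} \<subseteq> {0, 1} \<union> {n. f n \<noteq> 0} \<union> {n. g n \<noteq> 0}"
    by (auto simp: raw_mult_def)
  then have "finite {n. raw_mult f g n \<noteq> 0}"
    using assms[THEN carrier_finite_support] by (auto elim: finite_subset)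
  then show ?thesis
    by (simp add: mult_G reduce_in_carrier)
qed

lemma finite_support_add:
  "finite {n. f n \<noteq> 0} \<Longrightarrow> finite {n. g n \<noteq> 0} \<Longrightarrow> finite {n::nat. f n + g n \<noteq> (0::int)}"
  by (rule finite_subset[of _ "{n. f n \<noteq> 0} \<union> {n. g n \<noteq> 0}"]) auto

lemma pairing_mult_left:
  assumes "f \<in> carrier G" "g \<in> carrier G"
  shows "[pairing (f \<otimes>\<^bsub>G\<^esub> g) h = pairing f h + pairing g h] (mod int p)"
proof -
  note fin = assms[THEN carrier_finite_support]
  have "[pairing (f \<otimes>\<^bsub>G\<^esub> g) h = pairing (\<lambda>n. f n + g n) h] (mod int p)"
    by (intro pairing_cong carrier_finite_support mult_closed assms finite_support_add fin mult_2_mod_p)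
       auto
  then show ?thesis
    by (simp add: pairing_add_left fin)
qed

lemma pairing_mult_right:
  assumes "f \<in> carrier G"
  shows "[pairing f (g \<otimes>\<^bsub>G\<^esub> h) = pairing f g + pairing f h] (mod int p)"
proof -
  have "[pairing f (g \<otimes>\<^bsub>G\<^esub> h) = pairing f (\<lambda>n. g n + h n)] (mod int p)"
    by (intro pairing_cong carrier_finite_support assms mult_2_mod_p) auto
  then show ?thesis
    by (simp add: pairing_add_right)
qed

lemma mult_assoc:
  assumes f: "f \<in> carrier G" and g: "g \<in> carrier G" and h: "h \<in> carrier G"
  shows "(f \<otimes>\<^bsub>G\<^esub> g) \<otimes>\<^bsub>G\<^esub> h = f \<otimes>\<^bsub>G\<^esub> (g \<otimes>\<^bsub>G\<^esub> h)"
proof (rule carrier_eqI)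
  let ?l = "(f \<otimes>\<^bsub>G\<^esub> g) \<otimes>\<^bsub>G\<^esub> h" and ?r = "f \<otimes>\<^bsub>G\<^esub> (g \<otimes>\<^bsub>G\<^esub> h)"
  show "?l \<in> carrier G" "?r \<in> carrier G"
    using assms by (auto intro!: mult_closed)
  have "[?l 0 = f 0 + g 0 + h 0] (mod int p)"
    by (rule cong_trans[OF mult_0]) (intro cong_add mult_0 cong_refl)
  moreover have "[?r 0 = f 0 + (g 0 + h 0)] (mod int p)"
    by (rule cong_trans[OF mult_0]) (intro cong_add mult_0 cong_refl)
  ultimately show "[?l 0 = ?r 0] (mod int p)"
    by (simp add: cong_def add.assoc)
  have "[?l 1 = (f 1 + g 1 + pairing f g) + h 1 + (pairing f h + pairing g h)] (mod int p)"
    by (rule cong_trans[OF mult_1]) (intro cong_add mult_1 cong_refl pairing_mult_left f g)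
  moreover have "[?r 1 = f 1 + (g 1 + h 1 + pairing g h) + (pairing f g + pairing f h)] (mod int p)"
    by (rule cong_trans[OF mult_1]) (intro cong_add mult_1 cong_refl pairing_mult_right f)
  ultimately show "[?l 1 = ?r 1] (mod int p)"
    by (simp add: cong_def algebra_simps)
  fix n :: nat assume n: "n \<ge> 2"
  \<comment> \<open>The twist is a homomorphism from \<open>\<int>/p\<close> to the units of \<open>\<int>/p\<^sup>2\<close>.\<close>
  have twist: "[1 + int p * (g \<otimes>\<^bsub>G\<^esub> h) 0 = (1 + int p * g 0) * (1 + int p * h 0)] (mod (int p)\<^sup>2)"
  proof -
    have "int p dvd (g \<otimes>\<^bsub>G\<^esub> h) 0 - (g 0 + h 0)"
      using mult_0[of g h] by (simp add: cong_iff_dvd_diff)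
    then have "int p * int p dvd int p * ((g \<otimes>\<^bsub>G\<^esub> h) 0 - (g 0 + h 0)) - int p * int p * (g 0 * h 0)"
      by (rule dvd_diff[OF mult_dvd_mono[OF dvd_refl] dvd_triv_left])
    then show ?thesis
      by (simp add: cong_iff_dvd_diff power2_eq_square algebra_simps)
  qed
  have "[?l n = (f n * (1 + int p * g 0) + g n) * (1 + int p * h 0) + h n] (mod (int p)\<^sup>2)"
    by (rule cong_trans[OF mult_2[OF n]]) (intro cong_add cong_mult mult_2 n cong_refl)
  moreover have "[?r n = f n * ((1 + int p * g 0) * (1 + int p * h 0))
      + (g n * (1 + int p * h 0) + h n)] (mod (int p)\<^sup>2)"
    by (rule cong_trans[OF mult_2[OF n]]) (intro cong_add cong_mult mult_2 n cong_refl twist)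
  ultimately show "[?l n = ?r n] (mod (int p)\<^sup>2)"
    by (simp add: cong_def algebra_simps)
qed

lemma one_closed: "\<one>\<^bsub>G\<^esub> \<in> carrier G"
  by (simp add: G_def reduce_def fun_eq_iff)

lemma one_mult:
  assumes "f \<in> carrier G"
  shows "\<one>\<^bsub>G\<^esub> \<otimes>\<^bsub>G\<^esub> f = f"
proof (rule carrier_eqI)
  show "[(\<one>\<^bsub>G\<^esub> \<otimes>\<^bsub>G\<^esub> f) 0 = f 0] (mod int p)"
    using mult_0[of "\<one>\<^bsub>G\<^esub>" f] by simp
  show "[(\<one>\<^bsub>G\<^esub> \<otimes>\<^bsub>G\<^esub> f) 1 = f 1] (mod int p)"
    using mult_1[of "\<one>\<^bsub>G\<^esub>" f] by (simp add: pairing_zero_left)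
  show "[(\<one>\<^bsub>G\<^esub> \<otimes>\<^bsub>G\<^esub> f) n = f n] (mod (int p)\<^sup>2)" if "n \<ge> 2" for n
    using mult_2[OF that, of "\<one>\<^bsub>G\<^esub>" f] by simp
qed (rule mult_closed[OF one_closed assms], rule assms)

lemma left_inverse_ex:
  assumes f: "f \<in> carrier G"
  shows "\<exists>g\<in>carrier G. g \<otimes>\<^bsub>G\<^esub> f = \<one>\<^bsub>G\<^esub>"
proof -
  \<comment> \<open>The twist \<open>1 + p k\<close> has inverse \<open>1 - p k\<close> modulo \<open>p\<^sup>2\<close>; the sign of \<open>pairing f f\<close> comes from
    \<open>\<beta>(-a, a) = - \<beta>(a, a)\<close>.\<close>
  define r where "r n = (if n = 0 then - f 0 else if n = 1 then - f 1 + pairing f f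
    else - f n * (1 - int p * f 0))" for n
  have supp: "finite {n. r n \<noteq> 0}"
    by (rule finite_subset[of _ "{0, 1} \<union> {n. f n \<noteq> 0}"])
       (auto simp: r_def carrier_finite_support[OF f])
  define g where "g = reduce r"
  have g: "g \<in> carrier G"
    unfolding g_def by (rule reduce_in_carrier[OF supp])
  have g0: "[g 0 = - f 0] (mod int p)"
    and g1: "[g 1 = - f 1 + pairing f f] (mod int p)"
    and g2: "\<And>n. n \<ge> 2 \<Longrightarrow> [g n = - f n * (1 - int p * f 0)] (mod (int p)\<^sup>2)"
    by (simp_all add: g_def reduce_def r_def cong_def)
  have g2': "[g n + f n = 0] (mod int p)" if "n \<ge> 2" for n
  proof -
    have "[g n = - f n * (1 - int p * f 0)] (mod int p)"
      using g2[OF that] by (rule cong_dvd_modulus) (simp add: power2_eq_square)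
    then have "int p dvd (g n - (- f n * (1 - int p * f 0))) + int p * (f n * f 0)"
      by (intro dvd_add) (auto simp: cong_iff_dvd_diff)
    then show ?thesis
      by (simp add: cong_iff_dvd_diff algebra_simps)
  qed
  have "g \<otimes>\<^bsub>G\<^esub> f = \<one>\<^bsub>G\<^esub>"
  proof (rule carrier_eqI)
    show "g \<otimes>\<^bsub>G\<^esub> f \<in> carrier G" "\<one>\<^bsub>G\<^esub> \<in> carrier G"
      by (rule mult_closed[OF g f], rule one_closed)
    have "[(g \<otimes>\<^bsub>G\<^esub> f) 0 = - f 0 + f 0] (mod int p)"
      by (rule cong_trans[OF mult_0]) (intro cong_add g0 cong_refl)
    then show "[(g \<otimes>\<^bsub>G\<^esub> f) 0 = \<one>\<^bsub>G\<^esub> 0] (mod int p)"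
      by simp
    have "[pairing (\<lambda>n. g n + f n) f = pairing (\<lambda>_. 0) f] (mod int p)"
      by (rule pairing_cong) (simp_all add: finite_support_add carrier_finite_support f g g2')
    then have "[pairing g f + pairing f f = 0] (mod int p)"
      by (simp add: pairing_add_left carrier_finite_support f g pairing_zero_left)
    from cong_add[OF this cong_add[OF g1 cong_refl[of "f 1 - pairing f f"]]]
    have "[g 1 + f 1 + pairing g f = 0] (mod int p)"
      by (simp add: algebra_simps)
    then show "[(g \<otimes>\<^bsub>G\<^esub> f) 1 = \<one>\<^bsub>G\<^esub> 1] (mod int p)"
      unfolding one_G by (rule cong_trans[OF mult_1])
    fix n :: nat assume n: "n \<ge> 2"
    have "[(g \<otimes>\<^bsub>G\<^esub> f) n = - f n * (1 - int p * f 0) * (1 + int p * f 0) + f n] (mod (int p)\<^sup>2)"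
      by (rule cong_trans[OF mult_2[OF n]]) (intro cong_add cong_mult cong_refl g2 n)
    also have "- f n * (1 - int p * f 0) * (1 + int p * f 0) + f n = (int p)\<^sup>2 * (f n * (f 0)\<^sup>2)"
      by (simp add: algebra_simps power2_eq_square)
    finally show "[(g \<otimes>\<^bsub>G\<^esub> f) n = \<one>\<^bsub>G\<^esub> n] (mod (int p)\<^sup>2)"
      by (simp add: cong_def)
  qed
  with g show ?thesis by blast
qed

sublocale group G
  by (rule groupI)
     (auto intro: mult_closed one_closed mult_assoc one_mult left_inverse_ex)

lemma inv_0:
  assumes "f \<in> carrier G"
  shows "[(inv\<^bsub>G\<^esub> f) 0 = - f 0] (mod int p)"
  using cong_sym[OF mult_0[of "inv\<^bsub>G\<^esub> f" f]] assms by (simp add: cong_iff_dvd_diff)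

lemma inv_2:
  assumes "f \<in> carrier G" and "f 0 = 0" and "n \<ge> 2"
  shows "[(inv\<^bsub>G\<^esub> f) n = - f n] (mod (int p)\<^sup>2)"
  using cong_sym[OF mult_2[of n "inv\<^bsub>G\<^esub> f" f]] assms by (simp add: cong_iff_dvd_diff)

lemma carrier_zeroI: "f \<in> carrier G \<Longrightarrow> [f n = 0] (mod modulus n) \<Longrightarrow> f n = 0"
  using carrier_mod[of f n] by (simp add: cong_def)

definition base :: "(nat \<Rightarrow> int) set" where
  "base = {f \<in> carrier G. f 0 = 0}"

definition Z :: "(nat \<Rightarrow> int) set" where
  "Z = {f \<in> carrier G. \<forall>n. n \<noteq> 1 \<longrightarrow> f n = 0}"

text \<open>
  The triples \<open>(0, z, p a)\<close>: a central subgroup that contains every commutator.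
\<close>

definition C :: "(nat \<Rightarrow> int) set" where
  "C = {f \<in> base. \<forall>n\<ge>2. int p dvd f n}"

lemma base_in_carrier: "f \<in> base \<Longrightarrow> f \<in> carrier G"
  by (simp add: base_def)

lemma C_in_carrier: "f \<in> C \<Longrightarrow> f \<in> carrier G"
  by (simp add: C_def base_def)

lemma Z_subset_C: "Z \<subseteq> C"
  by (auto simp: Z_def C_def base_def)

lemma subgroup_base: "subgroup base G"
proof (rule subgroupI)
  fix f assume "f \<in> base"
  then have "[(inv\<^bsub>G\<^esub> f) 0 = 0] (mod modulus 0)" "f \<in> carrier G"
    using inv_0[of f] by (auto simp: base_def)
  then show "inv\<^bsub>G\<^esub> f \<in> base"
    using carrier_zeroI[of "inv\<^bsub>G\<^esub> f" 0] by (simp add: base_def)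
next
  fix f g assume "f \<in> base" "g \<in> base"
  then have "[(f \<otimes>\<^bsub>G\<^esub> g) 0 = 0] (mod modulus 0)" "f \<otimes>\<^bsub>G\<^esub> g \<in> carrier G"
    using mult_0[of f g] by (auto simp: base_def)
  then show "f \<otimes>\<^bsub>G\<^esub> g \<in> base"
    using carrier_zeroI[of "f \<otimes>\<^bsub>G\<^esub> g" 0] by (simp add: base_def)
qed (auto simp: base_def intro!: exI[of _ "\<one>\<^bsub>G\<^esub>"])

lemma pairing_p_dvd_left:
  assumes "f \<in> C"
  shows "[pairing f g = 0] (mod int p)"
proof -
  have "int p dvd pairing f g"
    unfolding pairing_def using assms by (intro dvd_sum) (simp add: C_def)
  then show ?thesis by (simp add: cong_0_iff)
qed

lemma pairing_p_dvd_right: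
  assumes "g \<in> C"
  shows "[pairing f g = 0] (mod int p)"
proof -
  have "int p dvd pairing f g"
    unfolding pairing_def using assms by (intro dvd_sum) (simp add: C_def)
  then show ?thesis by (simp add: cong_0_iff)
qed

lemma C_mult_twist:
  assumes "f \<in> C" and "n \<ge> 2"
  shows "[f n * (1 + int p * k) = f n] (mod (int p)\<^sup>2)"
proof -
  have "int p * int p dvd int p * f n"
    using assms by (intro mult_dvd_mono) (auto simp: C_def)
  then have "int p * int p dvd int p * f n * k"
    by (rule dvd_mult2)
  then show ?thesis
    by (simp add: cong_iff_dvd_diff power2_eq_square algebra_simps)
qed

text \<open>
  Multiples of \<open>p\<close> are annihilated by \<open>\<beta>\<close> modulo \<open>p\<close>, and \<open>(1 + p k) p a = p a\<close> modulo \<open>p\<^sup>2\<close>.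
\<close>

lemma C_central:
  assumes f: "f \<in> C" and g: "g \<in> carrier G"
  shows "f \<otimes>\<^bsub>G\<^esub> g = g \<otimes>\<^bsub>G\<^esub> f"
proof (rule carrier_eqI)
  show "f \<otimes>\<^bsub>G\<^esub> g \<in> carrier G" "g \<otimes>\<^bsub>G\<^esub> f \<in> carrier G"
    using C_in_carrier[OF f] g by auto
  show "[(f \<otimes>\<^bsub>G\<^esub> g) 0 = (g \<otimes>\<^bsub>G\<^esub> f) 0] (mod int p)"
    using cong_trans[OF mult_0[of f g] cong_sym[OF mult_0[of g f, unfolded add.commute[of "g 0"]]]] .
  have "[f 1 + g 1 + pairing f g = f 1 + g 1 + pairing g f] (mod int p)"
    by (intro cong_add cong_refl cong_trans[OF pairing_p_dvd_left[OF f]]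
        cong_sym[OF pairing_p_dvd_right[OF f]])
  then have "[(f \<otimes>\<^bsub>G\<^esub> g) 1 = g 1 + f 1 + pairing g f] (mod int p)"
    using mult_1[of f g] by (simp add: cong_def add.commute)
  then show "[(f \<otimes>\<^bsub>G\<^esub> g) 1 = (g \<otimes>\<^bsub>G\<^esub> f) 1] (mod int p)"
    using cong_trans[OF _ cong_sym[OF mult_1]] by blast
  fix n :: nat assume n: "n \<ge> 2"
  have "[(f \<otimes>\<^bsub>G\<^esub> g) n = f n + g n] (mod (int p)\<^sup>2)"
    by (rule cong_trans[OF mult_2[OF n]]) (intro cong_add cong_refl C_mult_twist f n)
  moreover have "[(g \<otimes>\<^bsub>G\<^esub> f) n = g n + f n] (mod (int p)\<^sup>2)"
    using mult_2[OF n, of g f] f by (simp add: C_def base_def)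
  ultimately show "[(f \<otimes>\<^bsub>G\<^esub> g) n = (g \<otimes>\<^bsub>G\<^esub> f) n] (mod (int p)\<^sup>2)"
    by (simp add: cong_def add.commute)
qed

section \<open>Nilpotency and exponent\<close>

text \<open>
  Components of a commutator \<open>c\<close> are read off from \<open>c (g f) = f g\<close>, which avoids computing inverses.
\<close>

lemma commutator_mult_swap:
  assumes "f \<in> carrier G" "g \<in> carrier G"
  shows "(f \<otimes>\<^bsub>G\<^esub> g \<otimes>\<^bsub>G\<^esub> inv\<^bsub>G\<^esub> f \<otimes>\<^bsub>G\<^esub> inv\<^bsub>G\<^esub> g) \<otimes>\<^bsub>G\<^esub> (g \<otimes>\<^bsub>G\<^esub> f) = f \<otimes>\<^bsub>G\<^esub> g"
proof -
  have "inv\<^bsub>G\<^esub> g \<otimes>\<^bsub>G\<^esub> (g \<otimes>\<^bsub>G\<^esub> f) = f"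
    using assms by (simp add: m_assoc[symmetric])
  then show ?thesis
    using assms by (simp add: m_assoc)
qed

lemma commutator_in_C:
  assumes f: "f \<in> carrier G" and g: "g \<in> carrier G"
  shows "f \<otimes>\<^bsub>G\<^esub> g \<otimes>\<^bsub>G\<^esub> inv\<^bsub>G\<^esub> f \<otimes>\<^bsub>G\<^esub> inv\<^bsub>G\<^esub> g \<in> C"
proof -
  let ?c = "f \<otimes>\<^bsub>G\<^esub> g \<otimes>\<^bsub>G\<^esub> inv\<^bsub>G\<^esub> f \<otimes>\<^bsub>G\<^esub> inv\<^bsub>G\<^esub> g"
  have c: "?c \<in> carrier G"
    using f g by simp
  note swap = commutator_mult_swap[OF f g]
  have "[?c 0 + (g 0 + f 0) = f 0 + g 0] (mod int p)"
    using cong_trans[OF cong_sym[OF cong_trans[OF mult_0[of ?c "g \<otimes>\<^bsub>G\<^esub> f", unfolded swap]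
        cong_add[OF cong_refl mult_0[of g f]]]] mult_0[of f g]] .
  then have "[?c 0 = 0] (mod modulus 0)"
    by (simp add: cong_iff_dvd_diff algebra_simps)
  moreover have "int p dvd ?c n" if n: "n \<ge> 2" for n
  proof -
    have "[?c n + (g n + f n) = f n + g n] (mod int p)"
      using cong_trans[OF cong_sym[OF cong_trans[OF mult_2_mod_p[OF n, of ?c "g \<otimes>\<^bsub>G\<^esub> f", unfolded swap]
          cong_add[OF cong_refl mult_2_mod_p[OF n, of g f]]]] mult_2_mod_p[OF n, of f g]] .
    then show ?thesis
      by (simp add: cong_iff_dvd_diff algebra_simps)
  qed
  ultimately show ?thesis
    using carrier_zeroI[OF c] c by (simp add: C_def base_def)
qed

lemma nilpotent: "nilpotent_group G"
proof -
  have central: "x \<otimes>\<^bsub>G\<^esub> y = y \<otimes>\<^bsub>G\<^esub> x" and closed: "x \<in> carrier G"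
    if "x \<in> lower_central G (Suc 0)" "y \<in> carrier G" for x y
  proof -
    let ?S = "\<Union>x\<in>carrier G. \<Union>y\<in>carrier G. {x \<otimes>\<^bsub>G\<^esub> y \<otimes>\<^bsub>G\<^esub> inv\<^bsub>G\<^esub> x \<otimes>\<^bsub>G\<^esub> inv\<^bsub>G\<^esub> y}"
    have x: "x \<in> generate G ?S"
      using that by simp
    have S: "?S \<subseteq> C"
      using commutator_in_C by blast
    then show "x \<otimes>\<^bsub>G\<^esub> y = y \<otimes>\<^bsub>G\<^esub> x"
      using x C_in_carrier C_central that(2) by (intro generate_commutes[OF x]) blast+
    show "x \<in> carrier G"
      using S C_in_carrier by (intro generate_in_carrier[OF _ x]) blast
  qed
  have "x \<otimes>\<^bsub>G\<^esub> y \<otimes>\<^bsub>G\<^esub> inv\<^bsub>G\<^esub> x \<otimes>\<^bsub>G\<^esub> inv\<^bsub>G\<^esub> y = \<one>\<^bsub>G\<^esub>"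
    if x: "x \<in> lower_central G (Suc 0)" and y: "y \<in> carrier G" for x y
  proof -
    have "x \<otimes>\<^bsub>G\<^esub> y \<otimes>\<^bsub>G\<^esub> inv\<^bsub>G\<^esub> x \<otimes>\<^bsub>G\<^esub> inv\<^bsub>G\<^esub> y = (y \<otimes>\<^bsub>G\<^esub> x) \<otimes>\<^bsub>G\<^esub> inv\<^bsub>G\<^esub> x \<otimes>\<^bsub>G\<^esub> inv\<^bsub>G\<^esub> y"
      by (simp only: central[OF x y])
    also have "\<dots> = \<one>\<^bsub>G\<^esub>"
      using closed[OF x y] y by (simp add: m_assoc)
    finally show ?thesis .
  qed
  then have "lower_central G (Suc (Suc 0)) \<subseteq> generate G {\<one>\<^bsub>G\<^esub>}"
    unfolding lower_central.simps(2)[of G "Suc 0"] by (intro mono_generate) blast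
  moreover have "\<one>\<^bsub>G\<^esub> \<in> lower_central G (Suc (Suc 0))"
    by (simp add: generate.one)
  ultimately have "lower_central G (Suc (Suc 0)) = {\<one>\<^bsub>G\<^esub>}"
    using generate_one by auto
  then show ?thesis
    unfolding nilpotent_group_def using is_group by blast
qed

lemma pow_0:
  assumes "f \<in> carrier G"
  shows "[(f [^]\<^bsub>G\<^esub> (m::nat)) 0 = int m * f 0] (mod int p)"
proof (induction m)
  case (Suc m)
  show ?case
    using cong_trans[OF mult_0[of "f [^]\<^bsub>G\<^esub> m" f] cong_add[OF Suc cong_refl]]
    by (simp add: algebra_simps)
qed simp

lemma pow_2:
  assumes "f \<in> base" and "n \<ge> 2"
  shows "[(f [^]\<^bsub>G\<^esub> (m::nat)) n = int m * f n] (mod (int p)\<^sup>2)"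
proof (induction m)
  case (Suc m)
  have "[(f [^]\<^bsub>G\<^esub> m \<otimes>\<^bsub>G\<^esub> f) n = (f [^]\<^bsub>G\<^esub> m) n + f n] (mod (int p)\<^sup>2)"
    using mult_2[OF assms(2), of "f [^]\<^bsub>G\<^esub> m" f] assms(1) by (simp add: base_def)
  from cong_trans[OF this cong_add[OF Suc cong_refl]] show ?case
    by (simp add: algebra_simps)
qed simp

lemma pow_1:
  assumes "f \<in> C"
  shows "[(f [^]\<^bsub>G\<^esub> (m::nat)) 1 = int m * f 1] (mod int p)"
proof (induction m)
  case (Suc m)
  have "[(f [^]\<^bsub>G\<^esub> m \<otimes>\<^bsub>G\<^esub> f) 1 = (int m * f 1 + f 1) + 0] (mod int p)"
    by (rule cong_trans[OF mult_1]) (intro cong_add Suc cong_refl pairing_p_dvd_right assms)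
  then show ?case
    by (simp add: algebra_simps)
qed simp

lemma pow_in_base: "f \<in> base \<Longrightarrow> f [^]\<^bsub>G\<^esub> (m::nat) \<in> base"
  using subgroup_base by (induction m) (auto intro: subgroup.m_closed subgroup.one_closed)

text \<open>
  Each of three successive \<open>p\<close>-th powers descends one step of \<open>G \<ge> base \<ge> C \<ge> 1\<close>.
\<close>

lemma exponent:
  assumes f: "f \<in> carrier G"
  shows "f [^]\<^bsub>G\<^esub> (p ^ 3) = \<one>\<^bsub>G\<^esub>"
proof -
  define g where "g = f [^]\<^bsub>G\<^esub> p"
  define h where "h = g [^]\<^bsub>G\<^esub> p"
  have "[g 0 = 0] (mod int p)"
    using pow_0[OF f, of p] by (simp add: g_def cong_def)
  then have g: "g \<in> base"
    using carrier_zeroI[of g 0] f by (simp add: base_def g_def)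
  have "int p dvd h n" if "n \<ge> 2" for n
  proof -
    have "[h n = int p * g n] (mod int p)"
      using pow_2[OF g that, of p] unfolding h_def
      by (rule cong_dvd_modulus) (simp add: power2_eq_square)
    then show ?thesis
      by (simp add: cong_dvd_iff)
  qed
  then have h: "h \<in> C"
    using pow_in_base[OF g] by (simp add: C_def h_def)
  have hb: "h \<in> base"
    using h by (simp add: C_def)
  have "h [^]\<^bsub>G\<^esub> p = \<one>\<^bsub>G\<^esub>"
  proof (rule carrier_eqI)
    show "h [^]\<^bsub>G\<^esub> p \<in> carrier G" "\<one>\<^bsub>G\<^esub> \<in> carrier G"
      using C_in_carrier[OF h] by auto
    show "[(h [^]\<^bsub>G\<^esub> p) 0 = \<one>\<^bsub>G\<^esub> 0] (mod int p)"
      using pow_0[OF C_in_carrier[OF h], of p] by (simp add: cong_def)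
    show "[(h [^]\<^bsub>G\<^esub> p) 1 = \<one>\<^bsub>G\<^esub> 1] (mod int p)"
      using pow_1[OF h, of p] by (simp add: cong_def)
    fix n :: nat assume n: "n \<ge> 2"
    have "(int p)\<^sup>2 dvd int p * h n"
      using h n unfolding power2_eq_square by (intro mult_dvd_mono) (auto simp: C_def)
    then show "[(h [^]\<^bsub>G\<^esub> p) n = \<one>\<^bsub>G\<^esub> n] (mod (int p)\<^sup>2)"
      using pow_2[OF hb n, of p] by (simp add: cong_def mod_eq_0_iff_dvd)
  qed
  then show ?thesis
    using f by (simp add: h_def g_def nat_pow_pow power3_eq_cube mult.assoc)
qed

lemma p_group_G: "p_group p G"
proof -
  have "\<exists>k. ord f = p ^ k" if "f \<in> carrier G" for f
  proof -
    have "ord f dvd p ^ 3"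
      using exponent[OF that] that by (simp add: pow_eq_id)
    then show ?thesis
      using prime_p by (auto simp: divides_primepow_nat)
  qed
  then show ?thesis
    using is_group by (simp add: p_group_def)
qed

section \<open>Subgroups are boundedly close to normal subgroups\<close>

lemma eq_up_to_Z:
  assumes x: "x \<in> carrier G" and y: "y \<in> carrier G" and "[x 0 = y 0] (mod int p)"
    and eq: "\<And>n. n \<ge> 2 \<Longrightarrow> [x n = y n] (mod (int p)\<^sup>2)"
  shows "\<exists>z\<in>Z. x = z \<otimes>\<^bsub>G\<^esub> y"
proof -
  define z where "z = reduce (\<lambda>n. if n = 1 then x 1 - y 1 else 0)"
  have z: "z \<in> Z"
    unfolding z_def Z_def
    by (simp add: reduce_in_carrier) (simp add: reduce_def)
  have z0: "z 0 = 0" and z2: "\<And>n. n \<ge> 2 \<Longrightarrow> z n = 0"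
    using z by (auto simp: Z_def)
  have z1: "[z 1 = x 1 - y 1] (mod int p)"
    by (simp add: z_def reduce_def cong_def)
  have "x = z \<otimes>\<^bsub>G\<^esub> y"
  proof (rule carrier_eqI)
    show "z \<otimes>\<^bsub>G\<^esub> y \<in> carrier G"
      using z y by (simp add: Z_def)
    show "[x 0 = (z \<otimes>\<^bsub>G\<^esub> y) 0] (mod int p)"
      using mult_0[of z y] z0 assms(3) by (simp add: cong_def)
    show "[x 1 = (z \<otimes>\<^bsub>G\<^esub> y) 1] (mod int p)"
      using cong_trans[OF mult_1[of z y] cong_add[OF cong_add[OF z1 cong_refl] cong_refl]]
      by (simp add: pairing_zero_left[OF z2] cong_def)
    show "[x n = (z \<otimes>\<^bsub>G\<^esub> y) n] (mod (int p)\<^sup>2)" if "n \<ge> 2" for n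
      using mult_2[OF that, of z y] z2[OF that] eq[OF that] by (simp add: cong_def)
  qed (fact x)
  with z show ?thesis by blast
qed

lemma subgroup_Z: "subgroup Z G"
proof (rule subgroupI)
  fix f assume f: "f \<in> Z"
  then have fc: "f \<in> carrier G" by (simp add: Z_def)
  have "(inv\<^bsub>G\<^esub> f) n = 0" if "n \<noteq> 1" for n
  proof (cases "n = 0")
    case True
    then show ?thesis
      using f inv_0[OF fc] carrier_zeroI[of "inv\<^bsub>G\<^esub> f" 0] by (simp add: Z_def)
  next
    case False
    then have "n \<ge> 2" using that by linarith
    then show ?thesis
      using f inv_2[OF fc, of n] carrier_zeroI[of "inv\<^bsub>G\<^esub> f" n] by (simp add: Z_def)
  qed
  then show "inv\<^bsub>G\<^esub> f \<in> Z"
    using fc by (simp add: Z_def)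
next
  fix f g assume fg: "f \<in> Z" "g \<in> Z"
  then have c: "f \<otimes>\<^bsub>G\<^esub> g \<in> carrier G" by (simp add: Z_def)
  have "(f \<otimes>\<^bsub>G\<^esub> g) n = 0" if "n \<noteq> 1" for n
  proof (cases "n = 0")
    case True
    then show ?thesis
      using fg mult_0[of f g] carrier_zeroI[OF c, of 0] by (simp add: Z_def)
  next
    case False
    then have "n \<ge> 2" using that by linarith
    then show ?thesis
      using fg mult_2[of n f g] carrier_zeroI[OF c, of n] by (simp add: Z_def)
  qed
  then show "f \<otimes>\<^bsub>G\<^esub> g \<in> Z"
    using c by (simp add: Z_def)
qed (auto simp: Z_def intro!: exI[of _ "\<one>\<^bsub>G\<^esub>"])

lemma Z_central: "z \<in> Z \<Longrightarrow> g \<in> carrier G \<Longrightarrow> z \<otimes>\<^bsub>G\<^esub> g = g \<otimes>\<^bsub>G\<^esub> z"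
  using Z_subset_C C_central by blast

lemma normal_Z: "Z \<lhd> G"
proof -
  have "x \<otimes>\<^bsub>G\<^esub> z \<otimes>\<^bsub>G\<^esub> inv\<^bsub>G\<^esub> x \<in> Z" if "x \<in> carrier G" "z \<in> Z" for x z
  proof -
    have "x \<otimes>\<^bsub>G\<^esub> z \<otimes>\<^bsub>G\<^esub> inv\<^bsub>G\<^esub> x = z \<otimes>\<^bsub>G\<^esub> x \<otimes>\<^bsub>G\<^esub> inv\<^bsub>G\<^esub> x"
      using that by (simp add: Z_central)
    also have "\<dots> = z"
      using that by (simp add: m_assoc Z_def)
    finally have "x \<otimes>\<^bsub>G\<^esub> z \<otimes>\<^bsub>G\<^esub> inv\<^bsub>G\<^esub> x = z" .
    then show ?thesis using that by simp
  qed
  then show ?thesis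
    using subgroup_Z normal_inv_iff by blast
qed

lemma finite_Z: "finite Z" and card_Z: "card Z \<le> p"
proof -
  have inj: "inj_on (\<lambda>f. f 1) Z"
  proof (rule inj_onI, rule ext)
    fix f g and n :: nat assume "f \<in> Z" "g \<in> Z" "f 1 = g 1"
    then show "f n = g n"
      by (cases "n = 1") (simp_all add: Z_def)
  qed
  have sub: "(\<lambda>f. f 1) ` Z \<subseteq> {0..<int p}"
  proof (rule image_subsetI)
    fix f assume "f \<in> Z"
    then show "f 1 \<in> {0..<int p}"
      using carrier_range[of f 1] by (simp add: Z_def)
  qed
  show "finite Z" using inj_on_finite[OF inj sub] by simp
  show "card Z \<le> p" using card_inj_on_le[OF inj sub] by simp
qed

text \<open>
  The power is \<open>1 + p k\<close>, where \<open>k\<close> is the first component of \<open>g\<close>: moving \<open>g\<close> past \<open>y = (0, z, a)\<close>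
  multiplies \<open>a\<close> by \<open>1 + p k\<close>, and everything else that changes lies in \<open>Z\<close>.
\<close>

lemma conj_eq_power:
  assumes y: "y \<in> base" and g: "g \<in> carrier G"
  shows "\<exists>z\<in>Z. \<exists>m::nat. inv\<^bsub>G\<^esub> g \<otimes>\<^bsub>G\<^esub> y \<otimes>\<^bsub>G\<^esub> g = z \<otimes>\<^bsub>G\<^esub> y [^]\<^bsub>G\<^esub> m"
proof -
  define m where "m = 1 + p * nat (g 0)"
  have m: "int m = 1 + int p * g 0"
    using carrier_range[OF g, of 0] by (simp add: m_def)
  note yc = base_in_carrier[OF y] and pb = pow_in_base[OF y, of m]
  note pc = base_in_carrier[OF pb]
  have "\<exists>z\<in>Z. y \<otimes>\<^bsub>G\<^esub> g = z \<otimes>\<^bsub>G\<^esub> (g \<otimes>\<^bsub>G\<^esub> y [^]\<^bsub>G\<^esub> m)"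
  proof (rule eq_up_to_Z)
    show "[(y \<otimes>\<^bsub>G\<^esub> g) 0 = (g \<otimes>\<^bsub>G\<^esub> y [^]\<^bsub>G\<^esub> m) 0] (mod int p)"
      using mult_0[of y g] mult_0[of g "y [^]\<^bsub>G\<^esub> m"] y pb by (simp add: base_def cong_def)
    fix n :: nat assume n: "n \<ge> 2"
    have "[(g \<otimes>\<^bsub>G\<^esub> y [^]\<^bsub>G\<^esub> m) n = g n + (y [^]\<^bsub>G\<^esub> m) n] (mod (int p)\<^sup>2)"
      using mult_2[OF n, of g "y [^]\<^bsub>G\<^esub> m"] pb by (simp add: base_def)
    from cong_trans[OF this cong_add[OF cong_refl pow_2[OF y n]]]
    show "[(y \<otimes>\<^bsub>G\<^esub> g) n = (g \<otimes>\<^bsub>G\<^esub> y [^]\<^bsub>G\<^esub> m) n] (mod (int p)\<^sup>2)"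
      using mult_2[OF n, of y g] unfolding m by (simp add: cong_def algebra_simps)
  qed (use yc pc g in auto)
  then obtain z where z: "z \<in> Z" "y \<otimes>\<^bsub>G\<^esub> g = z \<otimes>\<^bsub>G\<^esub> (g \<otimes>\<^bsub>G\<^esub> y [^]\<^bsub>G\<^esub> m)"
    by blast
  have zc: "z \<in> carrier G" using z by (simp add: Z_def)
  have "inv\<^bsub>G\<^esub> g \<otimes>\<^bsub>G\<^esub> y \<otimes>\<^bsub>G\<^esub> g = inv\<^bsub>G\<^esub> g \<otimes>\<^bsub>G\<^esub> (z \<otimes>\<^bsub>G\<^esub> g) \<otimes>\<^bsub>G\<^esub> y [^]\<^bsub>G\<^esub> m"
    using z g yc pc zc by (simp add: m_assoc)
  also have "\<dots> = z \<otimes>\<^bsub>G\<^esub> y [^]\<^bsub>G\<^esub> m"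
    using g pc zc by (simp add: Z_central[OF z(1)] m_assoc[symmetric])
  finally show ?thesis using z by blast
qed

text \<open>
  The subgroup \<open>L = H \<inter> base\<close> is normalised modulo \<open>Z\<close> because conjugation acts by powers, so
  \<open>N = Z L\<close> is normal. A coset of \<open>L\<close> in \<open>H N = H Z\<close> is determined by a first component, which is
  realised in \<open>H\<close>, and by an element of \<open>Z\<close>.
\<close>

lemma delta_le:
  assumes H: "subgroup H G"
  shows "delta G H \<le> enat (p * p)"
proof -
  define L where "L = H \<inter> base"
  define N where "N = Z <#>\<^bsub>G\<^esub> L"
  have L: "subgroup L G"
    unfolding L_def by (rule subgroups_Inter_pair[OF H subgroup_base])
  have HL: "L \<subseteq> H" "H \<subseteq> carrier G" and Lc: "L \<subseteq> carrier G" and Zc: "Z \<subseteq> carrier G"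
    using subgroup.subset[OF H] by (auto simp: L_def Z_def)
  have normal_N: "N \<lhd> G"
  proof -
    have "x \<otimes>\<^bsub>G\<^esub> a \<otimes>\<^bsub>G\<^esub> inv\<^bsub>G\<^esub> x \<in> N" if x: "x \<in> carrier G" and a: "a \<in> N" for x a
    proof -
      obtain z y where zy: "z \<in> Z" "y \<in> L" "a = z \<otimes>\<^bsub>G\<^esub> y"
        using a unfolding N_def set_mult_def by blast
      then have c: "z \<in> carrier G" "y \<in> carrier G" "y \<in> base"
        using Lc Zc by (auto simp: L_def)
      obtain w m where w: "w \<in> Z" "x \<otimes>\<^bsub>G\<^esub> y \<otimes>\<^bsub>G\<^esub> inv\<^bsub>G\<^esub> x = w \<otimes>\<^bsub>G\<^esub> y [^]\<^bsub>G\<^esub> (m::nat)"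
        using conj_eq_power[OF c(3), of "inv\<^bsub>G\<^esub> x"] x by auto
      have wc: "w \<in> carrier G" using w Zc by blast
      have "x \<otimes>\<^bsub>G\<^esub> a \<otimes>\<^bsub>G\<^esub> inv\<^bsub>G\<^esub> x = (x \<otimes>\<^bsub>G\<^esub> z) \<otimes>\<^bsub>G\<^esub> y \<otimes>\<^bsub>G\<^esub> inv\<^bsub>G\<^esub> x"
        using c x zy by (simp add: m_assoc)
      also have "\<dots> = z \<otimes>\<^bsub>G\<^esub> (x \<otimes>\<^bsub>G\<^esub> y \<otimes>\<^bsub>G\<^esub> inv\<^bsub>G\<^esub> x)"
        using c x by (simp add: Z_central[OF zy(1), symmetric] m_assoc)
      also have "\<dots> = (z \<otimes>\<^bsub>G\<^esub> w) \<otimes>\<^bsub>G\<^esub> y [^]\<^bsub>G\<^esub> m"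
        using c w wc by (simp add: m_assoc)
      finally have "x \<otimes>\<^bsub>G\<^esub> a \<otimes>\<^bsub>G\<^esub> inv\<^bsub>G\<^esub> x = (z \<otimes>\<^bsub>G\<^esub> w) \<otimes>\<^bsub>G\<^esub> y [^]\<^bsub>G\<^esub> m" .
      moreover have "z \<otimes>\<^bsub>G\<^esub> w \<in> Z"
        using zy w subgroup.m_closed[OF subgroup_Z] by blast
      moreover have "y [^]\<^bsub>G\<^esub> m \<in> L"
        using subgroup.one_closed[OF L] by (induction m) (auto intro: subgroup.m_closed[OF L] zy)
      ultimately show ?thesis
        unfolding N_def set_mult_def by blast
    qed
    then show ?thesis
      using mult_norm_subgroup[OF normal_Z L] normal_inv_iff unfolding N_def by blast
  qed
  have HN: "H \<inter> N = L"
  proof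
    have "y \<in> N" if "y \<in> L" for y
      using that Lc l_one[of y, symmetric] subgroup.one_closed[OF subgroup_Z] unfolding N_def set_mult_def by blast
    then show "L \<subseteq> H \<inter> N"
      using HL Lc by auto
    have "Z \<subseteq> base" by (auto simp: Z_def base_def)
    then have "N \<subseteq> base"
      using subgroup.m_closed[OF subgroup_base] by (auto simp: N_def set_mult_def L_def)
    then show "H \<inter> N \<subseteq> L"
      by (auto simp: L_def)
  qed
  define K where "K = (\<lambda>h. h 0) ` H"
  define c where "c = inv_into H (\<lambda>h. h (0::nat))"
  have c: "c k \<in> H" "c k 0 = k" if "k \<in> K" for k
    using inv_into_into[of k "\<lambda>h. h 0" H] f_inv_into_f[of k "\<lambda>h. h 0" H] that
    by (auto simp: K_def c_def)
  \<comment> \<open>\<open>c k\<close> represents the coset of \<open>L\<close> in \<open>H\<close> that consists of the elements with first component \<open>k\<close>.\<close>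
  define T where "T = (\<lambda>(k, z). c k \<otimes>\<^bsub>G\<^esub> z) ` (K \<times> Z)"
  have K: "K \<subseteq> {0..<int p}"
    using carrier_range[of _ 0] HL by (auto simp: K_def)
  then have finK: "finite K"
    by (rule finite_subset) simp
  have "card K \<le> p"
    using card_mono[OF _ K] by simp
  then have "card (K \<times> Z) \<le> p * p"
    by (simp add: card_cartesian_product card_Z mult_le_mono)
  then have cardT: "card T \<le> p * p"
    unfolding T_def using card_image_le[OF finite_cartesian_product[OF finK finite_Z]] le_trans by blast
  have "subgroup_index G (H <#>\<^bsub>G\<^esub> N) L \<le> enat (card T)"
  proof (rule subgroup_index_le_card_transversal)
    show "H <#>\<^bsub>G\<^esub> N \<subseteq> carrier G"
      using normal_imp_subgroup[OF normal_N] HL by (intro setmult_subset_G) (auto dest: subgroup.subset)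
    show "finite T"
      unfolding T_def using finK finite_Z by simp
    show "T \<subseteq> carrier G"
      unfolding T_def using c HL Zc by (auto intro!: mult_closed)
    fix x assume "x \<in> H <#>\<^bsub>G\<^esub> N"
    then obtain h z y where hzy: "h \<in> H" "z \<in> Z" "y \<in> L" and x: "x = h \<otimes>\<^bsub>G\<^esub> (z \<otimes>\<^bsub>G\<^esub> y)"
      unfolding N_def set_mult_def by blast
    define h' where "h' = h \<otimes>\<^bsub>G\<^esub> y"
    have h': "h' \<in> H"
      using hzy HL subgroup.m_closed[OF H] by (auto simp: h'_def)
    have k: "h' 0 \<in> K"
      using h' by (simp add: K_def)
    have zc: "z \<in> carrier G" and h'c: "h' \<in> carrier G" and cc: "c (h' 0) \<in> carrier G"
      using hzy Zc h' HL c[OF k] by auto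
    have "h \<in> carrier G" "y \<in> carrier G"
      using hzy HL Lc by auto
    then have "x = h' \<otimes>\<^bsub>G\<^esub> z"
      using zc by (simp add: x h'_def Z_central[OF hzy(2)] m_assoc)
    also have "\<dots> = (h' \<otimes>\<^bsub>G\<^esub> inv\<^bsub>G\<^esub> c (h' 0)) \<otimes>\<^bsub>G\<^esub> (c (h' 0) \<otimes>\<^bsub>G\<^esub> z)"
    proof -
      have "inv\<^bsub>G\<^esub> c (h' 0) \<otimes>\<^bsub>G\<^esub> (c (h' 0) \<otimes>\<^bsub>G\<^esub> z) = z"
        using zc cc by (simp add: m_assoc[symmetric])
      then show ?thesis
        using zc h'c cc by (simp add: m_assoc)
    qed
    finally have "x = \<dots>" .
    moreover have "h' \<otimes>\<^bsub>G\<^esub> inv\<^bsub>G\<^esub> c (h' 0) \<in> L"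
    proof -
      have "[(h' \<otimes>\<^bsub>G\<^esub> inv\<^bsub>G\<^esub> c (h' 0)) 0 = h' 0 + - h' 0] (mod int p)"
        using cong_trans[OF mult_0[of h' "inv\<^bsub>G\<^esub> c (h' 0)"] cong_add[OF cong_refl inv_0[OF cc]]] c[OF k] by simp
      then have "h' \<otimes>\<^bsub>G\<^esub> inv\<^bsub>G\<^esub> c (h' 0) \<in> base"
        using carrier_zeroI[of "h' \<otimes>\<^bsub>G\<^esub> inv\<^bsub>G\<^esub> c (h' 0)" 0] h'c cc by (simp add: base_def)
      then show ?thesis
        using h' c[OF k] subgroup.m_closed[OF H] subgroup.m_inv_closed[OF H] by (simp add: L_def)
    qed
    moreover have "c (h' 0) \<otimes>\<^bsub>G\<^esub> z \<in> T"
      unfolding T_def using k hzy by force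
    ultimately show "\<exists>t\<in>T. x \<in> L #>\<^bsub>G\<^esub> t"
      unfolding r_coset_def by blast
  qed (use L is_group in auto)
  also have "\<dots> \<le> enat (p * p)"
    using cardT by simp
  finally have "subgroup_index G (H <#>\<^bsub>G\<^esub> N) (H \<inter> N) \<le> enat (p * p)"
    by (simp add: HN)
  then show ?thesis
    unfolding delta_def using normal_N by (intro INF_lower2[of N]) auto
qed

lemma BCN_G: "BCN_group G"
  using delta_le by (simp only: BCN_group_def is_group) (intro conjI TrueI exI[of _ "p * p"] allI impI)

section \<open>Infinitely many commutators, no abelian subgroup of finite index\<close>

text \<open>
  The element \<open>(1, 0, 0)\<close> is \<open>unit 0\<close>; from index \<open>2\<close> on, these are the unit vectors of the last component.
\<close>

definition unit :: "nat \<Rightarrow> nat \<Rightarrow> int" where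
  "unit i = (\<lambda>n. if n = i then 1 else 0)"

lemma unit_in_carrier [simp]: "unit i \<in> carrier G"
proof -
  have "modulus i > 1"
    using p_gt_1 one_less_power[OF p_gt_1, of 2] by (simp add: modulus_def)
  then have "reduce (unit i) = unit i"
    by (auto simp: reduce_def unit_def)
  moreover have "finite {n. unit i n \<noteq> 0}"
    by (simp add: unit_def)
  ultimately show ?thesis by (simp add: G_def)
qed

lemma pairing_unit: "pairing (unit (2*i+2)) g = g (2*i+3)" "pairing (unit (2*i+3)) g = 0"
proof -
  have "{j. unit (2*i+2) (2*j+2) \<noteq> 0} = {i}"
    by (auto simp: unit_def)
  then show "pairing (unit (2*i+2)) g = g (2*i+3)"
    by (simp add: pairing_def) (simp add: unit_def)
  have "{j. unit (2*i+3) (2*j+2) \<noteq> 0} = {}"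
    by (auto simp: unit_def) presburger
  then show "pairing (unit (2*i+3)) g = 0"
    by (simp add: pairing_def)
qed

text \<open>
  The commutators of \<open>unit i\<close> with \<open>unit 0\<close> are pairwise different, since they are \<open>p e\<^sub>i\<close> up to
  their component in \<open>Z\<close>.
\<close>

lemma not_finite_by_abelian_G: "\<not> finite_by_abelian G"
proof
  assume "finite_by_abelian G"
  then have fin: "finite (derived G (carrier G))"
    by (simp add: finite_by_abelian_def)
  define d where "d i = unit i \<otimes>\<^bsub>G\<^esub> unit 0 \<otimes>\<^bsub>G\<^esub> inv\<^bsub>G\<^esub> unit i \<otimes>\<^bsub>G\<^esub> inv\<^bsub>G\<^esub> unit 0" for i
  have "d i \<in> derived G (carrier G)" for i
    unfolding derived_def d_def by (rule generate.incl) (blast intro: unit_in_carrier)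
  then have finite_range: "finite (d ` {2..})"
    by (auto intro: finite_subset[OF _ fin])
  have d: "[d i n = int p * unit i n] (mod (int p)\<^sup>2)" if n: "n \<ge> 2" for i n
  proof -
    have C: "d i \<in> C"
      unfolding d_def by (rule commutator_in_C) auto
    have swap: "d i \<otimes>\<^bsub>G\<^esub> (unit 0 \<otimes>\<^bsub>G\<^esub> unit i) = unit i \<otimes>\<^bsub>G\<^esub> unit 0"
      unfolding d_def by (rule commutator_mult_swap) auto
    let ?e = "unit 0 \<otimes>\<^bsub>G\<^esub> unit i"
    have "[?e n = unit i n] (mod (int p)\<^sup>2)"
      using mult_2[OF n, of "unit 0" "unit i"] n by (simp add: unit_def)
    from cong_trans[OF mult_2[OF n, of "d i" ?e] cong_add[OF C_mult_twist[OF C n] this]]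
    have "[(unit i \<otimes>\<^bsub>G\<^esub> unit 0) n = d i n + unit i n] (mod (int p)\<^sup>2)"
      by (simp add: swap)
    moreover have "[(unit i \<otimes>\<^bsub>G\<^esub> unit 0) n = unit i n * (1 + int p)] (mod (int p)\<^sup>2)"
      using mult_2[OF n, of "unit i" "unit 0"] n by (simp add: unit_def)
    ultimately have "[d i n + unit i n = unit i n * (1 + int p)] (mod (int p)\<^sup>2)"
      by (simp add: cong_def)
    then show ?thesis
      by (simp add: cong_iff_dvd_diff algebra_simps)
  qed
  have "inj_on d {2..}"
  proof (rule inj_onI, rule ccontr)
    fix i j :: nat assume ij: "i \<in> {2..}" "d i = d j" "i \<noteq> j"
    have "[int p * unit i i = int p * unit j i] (mod (int p)\<^sup>2)"
      using d[of i i] d[of i j] ij by (simp add: cong_def)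
    then have "(int p)\<^sup>2 dvd int p"
      using ij by (simp add: unit_def cong_iff_dvd_diff)
    then have "(int p)\<^sup>2 \<le> int p"
      using p_gt_1 by (intro zdvd_imp_le) auto
    then show False
      using p_gt_1 by (simp add: power2_eq_square)
  qed
  with finite_range have "finite {2::nat..}"
    using finite_imageD by blast
  then show False
    using infinite_Ici by blast
qed

lemma pairing_inv_left:
  assumes "f \<in> carrier G"
  shows "[pairing (inv\<^bsub>G\<^esub> f) h = - pairing f h] (mod int p)"
  using cong_sym[OF pairing_mult_left[of "inv\<^bsub>G\<^esub> f" f h]] assms
  by (simp add: pairing_zero_left cong_iff_dvd_diff)

lemma pairing_inv_right:
  assumes "f \<in> carrier G" "h \<in> carrier G"
  shows "[pairing f (inv\<^bsub>G\<^esub> h) = - pairing f h] (mod int p)"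
  using cong_sym[OF pairing_mult_right[of f "inv\<^bsub>G\<^esub> h" h]] assms
  by (simp add: pairing_zero_right cong_iff_dvd_diff)

lemma pairing_quotients:
  assumes "f \<in> carrier G" "f' \<in> carrier G" "g \<in> carrier G" "g' \<in> carrier G"
  shows "[pairing (f \<otimes>\<^bsub>G\<^esub> inv\<^bsub>G\<^esub> f') (g \<otimes>\<^bsub>G\<^esub> inv\<^bsub>G\<^esub> g')
    = (pairing f g - pairing f g') - (pairing f' g - pairing f' g')] (mod int p)"
proof -
  have right: "[pairing e (g \<otimes>\<^bsub>G\<^esub> inv\<^bsub>G\<^esub> g') = pairing e g - pairing e g'] (mod int p)"
    if "e \<in> carrier G" for e
    using cong_trans[OF pairing_mult_right[OF that] cong_add[OF cong_refl pairing_inv_right[OF that assms(4)]]]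
    by simp
  have "[pairing (f \<otimes>\<^bsub>G\<^esub> inv\<^bsub>G\<^esub> f') h = pairing f h - pairing f' h] (mod int p)" for h
    using cong_trans[OF pairing_mult_left cong_add[OF cong_refl pairing_inv_left[OF assms(2)]]] assms
    by simp
  from cong_trans[OF this cong_diff[OF right right]] show ?thesis
    using assms by simp
qed

lemma pairing_eq_if_commute:
  assumes "u \<otimes>\<^bsub>G\<^esub> v = v \<otimes>\<^bsub>G\<^esub> u"
  shows "[pairing u v = pairing v u] (mod int p)"
proof -
  have "[u 1 + v 1 + pairing u v = v 1 + u 1 + pairing v u] (mod int p)"
    using cong_trans[OF cong_sym[OF mult_1[of u v]] mult_1[of v u, folded assms]] .
  then show ?thesis
    by (simp add: cong_iff_dvd_diff algebra_simps)
qed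

text \<open>
  Among the pairs of unit vectors \<open>x\<^sub>i, y\<^sub>i\<close> with \<open>\<beta>(x\<^sub>i, y\<^sub>j) = \<delta>\<^sub>i\<^sub>j\<close> there are three different
  indices \<open>i, j, k\<close> whose \<open>x\<close> share a coset of \<open>A\<close> and whose \<open>y\<close> share one. Then
  \<open>u = x\<^sub>i x\<^sub>j\<^sup>-\<^sup>1\<close> and \<open>v = y\<^sub>i y\<^sub>k\<^sup>-\<^sup>1\<close> lie in \<open>A\<close>, while \<open>\<beta>(u, v) = 1\<close> and \<open>\<beta>(v, u) = 0\<close>. With only two
  indices, \<open>k = j\<close>, the value would be \<open>\<beta>(u, v) = 2\<close>, which vanishes for \<open>p = 2\<close>.
\<close>

lemma not_abelian_by_finite_G: "\<not> abelian_by_finite G"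
proof
  assume "abelian_by_finite G"
  then obtain A where A: "subgroup A G" and comm: "comm_group (G\<lparr>carrier := A\<rparr>)"
    and index: "subgroup_index G (carrier G) A < \<infinity>"
    by (auto simp: abelian_by_finite_def)
  have fin: "finite (rcosets\<^bsub>G\<^esub> A)"
    using index by (auto simp: subgroup_index_def Let_def split: if_splits)
  define x where "x i = unit (2*i+2)" for i
  define y where "y i = unit (2*i+3)" for i
  have xy: "x i \<in> carrier G" "y i \<in> carrier G" for i
    by (simp_all add: x_def y_def)
  define \<phi> where "\<phi> i = (A #>\<^bsub>G\<^esub> x i, A #>\<^bsub>G\<^esub> y i)" for i
  have "range \<phi> \<subseteq> (rcosets\<^bsub>G\<^esub> A) \<times> (rcosets\<^bsub>G\<^esub> A)"
    using xy by (auto simp: \<phi>_def RCOSETS_def)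
  then have "finite (range \<phi>)"
    using fin finite_subset by blast
  then obtain i where inf: "infinite {j. \<phi> j = \<phi> i}"
    using pigeonhole_infinite[of UNIV \<phi>] by auto
  then obtain j where j: "\<phi> j = \<phi> i" "j \<noteq> i"
    using infinite_imp_nonempty[OF infinite_remove[OF inf, of i]] by blast
  obtain k where k: "\<phi> k = \<phi> i" "k \<noteq> i" "k \<noteq> j"
    using infinite_imp_nonempty[OF infinite_remove[OF infinite_remove[OF inf, of i], of j]] by blast
  have quot: "a \<otimes>\<^bsub>G\<^esub> inv\<^bsub>G\<^esub> b \<in> A"
    if "A #>\<^bsub>G\<^esub> b = A #>\<^bsub>G\<^esub> a" "a \<in> carrier G" "b \<in> carrier G" for a b
    using subgroup.rcos_module_imp[OF A is_group that(3), of a] rcos_self[OF that(2) A] that(1) by simp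
  have u: "x i \<otimes>\<^bsub>G\<^esub> inv\<^bsub>G\<^esub> x j \<in> A" and v: "y i \<otimes>\<^bsub>G\<^esub> inv\<^bsub>G\<^esub> y k \<in> A"
    using j k xy by (auto intro!: quot simp: \<phi>_def)
  let ?u = "x i \<otimes>\<^bsub>G\<^esub> inv\<^bsub>G\<^esub> x j" and ?v = "y i \<otimes>\<^bsub>G\<^esub> inv\<^bsub>G\<^esub> y k"
  have "?u \<otimes>\<^bsub>G\<^esub> ?v = ?v \<otimes>\<^bsub>G\<^esub> ?u"
    using comm_groupE(4)[OF comm, of ?u ?v] u v by simp
  then have "[pairing ?u ?v = pairing ?v ?u] (mod int p)"
    by (rule pairing_eq_if_commute)
  moreover have "[pairing ?u ?v = 1] (mod int p)"
    using pairing_quotients[of "x i" "x j" "y i" "y k"] xy j k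
    unfolding x_def pairing_unit by (simp add: y_def unit_def)
  moreover have "[pairing ?v ?u = 0] (mod int p)"
    using pairing_quotients[of "y i" "y k" "x i" "x j"] xy
    unfolding y_def pairing_unit by simp
  ultimately have "[1 = 0] (mod int p)"
    by (simp add: cong_def)
  then show False
    using p_gt_1 by (simp add: cong_def)
qed

end

theorem proposition1p2:
  fixes p :: nat
  assumes "Factorial_Ring.prime p"
  shows "\<exists>G :: (nat \<Rightarrow> int) monoid.
    group G \<and> nilpotent_group G \<and> p_group p G \<and> BCN_group G \<and>
    \<not> abelian_by_finite G \<and> \<not> finite_by_abelian G"
proof -
  interpret twisted_heisenberg p
    by (rule twisted_heisenberg.intro) (fact assms)
  show ?thesis
    by (intro exI[of _ G] conjI is_group nilpotent p_group_G BCN_G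
        not_abelian_by_finite_G not_finite_by_abelian_G)
qed

end
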